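(* (The Diamond Lemma I) Let $\mathbf k$ be a commutative ring, $V$ a free $\mathbf k$-module with basis $(v_i)_{i\in I}$ labeled by a partially ordered set $(I,\prec)$ satisfying the descending chain condition, $W\subseteq V$ a submodule, and $S=(w_j)_{j\in J}$ a confluent spanning set for $W$. For any choices of representatives $R_i\subseteq\mathbf k$ of $\mathbf k/Y_i$ (i.e. $R_i$ maps bijectively to $\mathbf k/Y_i$), $i\in I$, such that $0\in R_i$ for all but finitely many $i$, every class in $V/W$ has a unique expression as (the class of) a linear combination $\sum_i\mu_iv_i$ with $\mu_i\in R_i$ for all $i$ (and all but finitely many $\mu_i$ zero).
   Context: An element $w=\sum_i\lambda_iv_i\in V$ defines a reduction if there is a (unique) index $\psi\in I$ with $\lambda_\psi\ne0$ such that $\lambda_i\ne0$ implies $i\preceq\psi$; for $w_j$ write $\psi(j)$ for this index. For a family $S=(w_j)_{j\in J}$ of elements defining reductions, let $S_i=\{w_j:\psi(j)=i\}$, and $V_{\prec i}=\mathrm{Span}(v_\ell:\ell\prec i)$ (spans are $\mathbf k$-linear). $S$ is a confluent set if for all $i\in I$, $\mathrm{Span}(S_i)\cap V_{\prec i}\subseteq\mathrm{Span}\big(\bigcup_{\ell\prec i}S_\ell\big)$. It is a confluent spanning set for $W$ if moreover $S\subseteq W$ and $S$ spans $W$ over $\mathbf k$. $Y_i\subseteq\mathbf k$ is the ideal generated by all $\lambda\in\mathbf k$ such that some $w_j\in S$ has the form $w_j=\lambda v_i+\sum_{i'\prec i}\mu_{i'}v_{i'}$ with $\psi(j)=i$.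 *)

theory Defs
  imports "HOL.Modules"
begin

definition descending_chain_condition :: "'i::order set \<Rightarrow> bool" where
  "descending_chain_condition I \<longleftrightarrow>
     \<not> (\<exists>f :: nat \<Rightarrow> 'i. \<forall>n. f n \<in> I \<and> f (Suc n) < f n)"

definition cong_mod :: "'c::ab_group_add set \<Rightarrow> ('c \<times> 'c) set" where
  "cong_mod H = {(x, y). x - y \<in> H}"

text \<open>A commutative ring is a module over itself, and its submodules are its ideals.\<close>

lemma module_times: "module ((*) :: 'a::comm_ring_1 \<Rightarrow> 'a \<Rightarrow> 'a)"
  by unfold_locales (simp_all add: algebra_simps)

definition ideal_generated_by :: "'a::comm_ring_1 set \<Rightarrow> 'a set" where
  "ideal_generated_by X = module.span (*) X"

definition representatives_mod :: "'a::comm_ring_1 set \<Rightarrow> 'a set \<Rightarrow> bool" where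
  "representatives_mod Y R \<longleftrightarrow>
     bij_betw (\<lambda>a. cong_mod Y `` {a}) R (UNIV // cong_mod Y)"

context module
begin

definition is_basis :: "'i set \<Rightarrow> ('i \<Rightarrow> 'b) \<Rightarrow> bool" where
  "is_basis I v \<longleftrightarrow> inj_on v I \<and> independent (v ` I) \<and> span (v ` I) = UNIV"

definition coord :: "'i set \<Rightarrow> ('i \<Rightarrow> 'b) \<Rightarrow> 'b \<Rightarrow> 'i \<Rightarrow> 'a" where
  "coord I v x i = representation (v ` I) x (v i)"

definition leads_at :: "'i::order set \<Rightarrow> ('i \<Rightarrow> 'b) \<Rightarrow> 'b \<Rightarrow> 'i \<Rightarrow> bool" where
  "leads_at I v x p \<longleftrightarrow>
     p \<in> I \<and> coord I v x p \<noteq> 0 \<and> (\<forall>i\<in>I. coord I v x i \<noteq> 0 \<longrightarrow> i \<le> p)"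

definition defines_reduction :: "'i::order set \<Rightarrow> ('i \<Rightarrow> 'b) \<Rightarrow> 'b \<Rightarrow> bool" where
  "defines_reduction I v x \<longleftrightarrow> (\<exists>!p. leads_at I v x p)"

definition lead_index :: "'i::order set \<Rightarrow> ('i \<Rightarrow> 'b) \<Rightarrow> 'b \<Rightarrow> 'i" where
  "lead_index I v x = (THE p. leads_at I v x p)"

definition elements_at ::
    "'i::order set \<Rightarrow> ('i \<Rightarrow> 'b) \<Rightarrow> 'j set \<Rightarrow> ('j \<Rightarrow> 'b) \<Rightarrow> 'i \<Rightarrow> 'b set" where
  "elements_at I v J w i = {w j | j. j \<in> J \<and> lead_index I v (w j) = i}"

definition span_below :: "'i::order set \<Rightarrow> ('i \<Rightarrow> 'b) \<Rightarrow> 'i \<Rightarrow> 'b set" where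
  "span_below I v i = span {v l | l. l \<in> I \<and> l < i}"

definition confluent_set ::
    "'i::order set \<Rightarrow> ('i \<Rightarrow> 'b) \<Rightarrow> 'j set \<Rightarrow> ('j \<Rightarrow> 'b) \<Rightarrow> bool" where
  "confluent_set I v J w \<longleftrightarrow>
     (\<forall>j\<in>J. defines_reduction I v (w j)) \<and>
     (\<forall>i\<in>I. span (elements_at I v J w i) \<inter> span_below I v i
              \<subseteq> span (\<Union>l\<in>{l\<in>I. l < i}. elements_at I v J w l))"

definition confluent_spanning_set ::
    "'i::order set \<Rightarrow> ('i \<Rightarrow> 'b) \<Rightarrow> 'j set \<Rightarrow> ('j \<Rightarrow> 'b) \<Rightarrow> 'b set \<Rightarrow> bool" where
  "confluent_spanning_set I v J w W \<longleftrightarrow>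
     confluent_set I v J w \<and> w ` J \<subseteq> W \<and> span (w ` J) = W"

definition lead_ideal ::
    "'i::order set \<Rightarrow> ('i \<Rightarrow> 'b) \<Rightarrow> 'j set \<Rightarrow> ('j \<Rightarrow> 'b) \<Rightarrow> 'i \<Rightarrow> 'a set" where
  "lead_ideal I v J w i = ideal_generated_by
     {c. \<exists>j\<in>J. lead_index I v (w j) = i \<and> (\<exists>u\<in>span_below I v i. w j = c *s v i + u)}"

end

end

theory Submission
  imports Defs
begin

text \<open>
  Since the order is well-founded, so is the order \<^const>\<open>max_ext\<close> on finite sets of indices in which
  a set decreases when all of its maximal elements are replaced by finitely many smaller indices.
  For uniqueness, write a nonzero element of \<open>W\<close> as a finite sum of elements
  \<open>y i \<in> Span(S_i)\<close>. Either for some maximal \<open>i\<close> the coefficient of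
  \<open>v i\<close> survives, and then it lies in \<open>Y_i\<close>; or every maximal summand lies in
  \<open>V_{< i}\<close>, and confluence rewrites all of them at once by smaller indices.
  For existence, reduce the coefficients at the maximal indices of a finite set containing the
  support. This only creates terms at smaller indices, and the finitely many indices with
  \<open>0 \<notin> R_i\<close> are carried along in the finite set.
\<close>

section \<open>Residue classes, representatives, and spans of unions\<close>

text \<open>A submodule contains 0 and is closed under sums and differences. Used twice: for V/W,
  and for k/Y_i with the ring as a module over itself.\<close>

lemma (in module) cong_mod_class_eq_iff:
  assumes "subspace H"
  shows "cong_mod H `` {x} = cong_mod H `` {y} \<longleftrightarrow> x - y \<in> H"
proof
  assume eq: "cong_mod H `` {x} = cong_mod H `` {y}"
  have "y \<in> cong_mod H `` {y}"
    using subspace_0[OF assms] by (simp add: cong_mod_def)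
  with eq show "x - y \<in> H" by (auto simp: cong_mod_def)
next
  assume xy: "x - y \<in> H"
  have "x - z \<in> H \<longleftrightarrow> y - z \<in> H" for z
    using subspace_add[OF assms xy, of "y - z"] subspace_diff[OF assms _ xy, of "x - z"] by auto
  then show "cong_mod H `` {x} = cong_mod H `` {y}" by (auto simp: cong_mod_def)
qed

text \<open>Surjectivity of the class map on \<open>R\<close>; this half yields existence of normal
  forms.\<close>

lemma representatives_mod_ex:
  assumes Y: "module.subspace (*) Y" and R: "representatives_mod Y R"
  shows "\<exists>r\<in>R. c - r \<in> Y"
proof -
  have "cong_mod Y `` {c} \<in> UNIV // cong_mod Y" by (simp add: quotientI)
  then obtain r where "r \<in> R" "cong_mod Y `` {c} = cong_mod Y `` {r}"
    using R unfolding representatives_mod_def bij_betw_def by auto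
  then show ?thesis
    using module.cong_mod_class_eq_iff[OF module_times Y] by blast
qed

text \<open>Injectivity of the class map on \<open>R\<close>; this half yields uniqueness.\<close>

lemma representatives_mod_unique:
  assumes Y: "module.subspace (*) Y" and R: "representatives_mod Y R"
    and "r \<in> R" "s \<in> R" "r - s \<in> Y"
  shows "r = s"
  using assms module.cong_mod_class_eq_iff[OF module_times Y, of r s]
  by (auto simp: representatives_mod_def bij_betw_def inj_on_def)

text \<open>The generators in a linear combination are grouped so that each index contributes one
  summand. Making \<open>y\<close> total, with value 0 off \<open>F\<close>, lets a generator be
  added without asking whether its index is already in \<open>F\<close>.\<close>

lemma (in module) span_UN_finite_sum:
  assumes "x \<in> span (\<Union>i\<in>D. S i)"
  shows "\<exists>F y. finite F \<and> F \<subseteq> D \<and> (\<forall>i. y i \<in> span (S i)) \<and> (\<forall>i. i \<notin> F \<longrightarrow> y i = 0) \<and>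
    x = sum y F"
  using assms
proof (induction rule: span_induct_alt)
  case base
  show ?case
    by (rule exI[of _ "{}"], rule exI[of _ "\<lambda>_. 0"]) (auto simp: span_zero)
next
  case (step c a x)
  then obtain F y i where F: "finite F" "F \<subseteq> D" and y: "\<And>i. y i \<in> span (S i)"
    and y0: "\<And>i. i \<notin> F \<Longrightarrow> y i = 0" and x: "x = sum y F" and i: "i \<in> D" "a \<in> S i"
    by auto
  let ?y = "y(i := c *s a + y i)"
  have "sum y F = sum y (insert i F)"
    using F y0 by (intro sum.mono_neutral_left) auto
  also have "\<dots> = y i + sum y (F - {i})"
    using F by (simp add: sum.insert_remove)
  finally have "c *s a + x = (c *s a + y i) + sum y (F - {i})"
    by (simp add: x add.assoc)
  also have "sum y (F - {i}) = sum ?y (F - {i})"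
    by (intro sum.cong) auto
  also have "(c *s a + y i) + sum ?y (F - {i}) = sum ?y (insert i F)"
    using F by (simp add: sum.insert_remove)
  finally have "c *s a + x = sum ?y (insert i F)" .
  moreover have "c *s a + y i \<in> span (S i)"
    using i(2) y by (simp add: span_add span_scale span_base)
  ultimately show ?case
    using F y y0 i by (intro exI[of _ "insert i F"] exI[of _ ?y] conjI allI impI) (simp_all del: sum.insert)
qed

section \<open>Well-founded order on finite index sets; coordinates in the basis\<close>

locale ordered_basis = module scale
  for scale :: "'a::comm_ring_1 \<Rightarrow> 'b::ab_group_add \<Rightarrow> 'b" (infixr "*s" 75) +
  fixes I :: "'i::order set" and v :: "'i \<Rightarrow> 'b"
  assumes basis: "is_basis I v"
    and dcc: "descending_chain_condition I"
begin

text \<open>Comparisons are confined to \<open>I\<close> because the descending chain condition says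
  nothing about the rest of the index type.\<close>

definition replacement :: "('i set \<times> 'i set) set" where
  "replacement = max_ext {(i, j). i \<in> I \<and> j \<in> I \<and> i < j}"

lemma wf_replacement: "wf replacement"
proof -
  have "wf {(i, j). i \<in> I \<and> j \<in> I \<and> i < j}"
    using dcc by (auto simp: wf_iff_no_infinite_down_chain descending_chain_condition_def)
  then show ?thesis
    unfolding replacement_def by (rule max_ext_wf)
qed

lemma replacementI:
  assumes "finite A" "finite B" "A \<subseteq> I" "B \<subseteq> I" "B \<noteq> {}"
    and "\<And>i. i \<in> A \<Longrightarrow> \<exists>b\<in>B. i < b"
  shows "(A, B) \<in> replacement"
  unfolding replacement_def
proof (rule max_extI)
  fix i assume "i \<in> A"
  with assms(6) obtain b where "b \<in> B" "i < b" by blast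
  with \<open>i \<in> A\<close> assms(3,4) show "\<exists>b\<in>B. (i, b) \<in> {(i, j). i \<in> I \<and> j \<in> I \<and> i < j}" by auto
qed (use assms in auto)

lemma inj_v: "inj_on v I" and indep: "independent (v ` I)" and spans: "span (v ` I) = UNIV"
  using basis by (auto simp: is_basis_def)

abbreviation co :: "'b \<Rightarrow> 'i \<Rightarrow> 'a" where
  "co \<equiv> coord I v"

lemma coord_zero: "co 0 i = 0"
  by (simp add: coord_def representation_zero)

lemma coord_add: "co (x + y) i = co x i + co y i"
  by (simp add: coord_def representation_add indep spans)

lemma coord_diff: "co (x - y) i = co x i - co y i"
  by (simp add: coord_def representation_diff indep spans)

lemma coord_scale: "co (c *s x) i = c * co x i"
  by (simp add: coord_def representation_scale indep spans)

lemma coord_sum: "co (sum f A) i = (\<Sum>a\<in>A. co (f a) i)"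
  by (simp add: coord_def representation_sum indep spans)

lemma coord_basis: "i \<in> I \<Longrightarrow> l \<in> I \<Longrightarrow> co (v l) i = (if i = l then 1 else 0)"
  using inj_v by (auto simp: coord_def representation_basis indep inj_on_def)

lemma coord_basis_sum:
  assumes "finite A" "A \<subseteq> I" "i \<in> I"
  shows "co (\<Sum>l\<in>A. f l *s v l) i = (if i \<in> A then f i else 0)"
proof -
  have "co (\<Sum>l\<in>A. f l *s v l) i = (\<Sum>l\<in>A. if l = i then f l else 0)"
    unfolding coord_sum coord_scale using assms by (intro sum.cong) (auto simp: coord_basis)
  then show ?thesis using assms by simp
qed

lemma finite_support: "finite {i \<in> I. co x i \<noteq> 0}"
proof (rule finite_imageD)
  show "finite (v ` {i \<in> I. co x i \<noteq> 0})"
    by (rule finite_subset[OF _ finite_representation[of "v ` I" x]]) (auto simp: coord_def)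
  show "inj_on v {i \<in> I. co x i \<noteq> 0}"
    using inj_v by (rule inj_on_subset) auto
qed

lemma sum_coord: "(\<Sum>i\<in>{i \<in> I. co x i \<noteq> 0}. co x i *s v i) = x"
proof -
  have "inj_on v {i \<in> I. co x i \<noteq> 0}"
    using inj_v by (rule inj_on_subset) auto
  moreover have "v ` {i \<in> I. co x i \<noteq> 0} = {b. representation (v ` I) x b \<noteq> 0}"
    using representation_ne_zero[of "v ` I" x] by (force simp: coord_def)
  ultimately have "(\<Sum>b | representation (v ` I) x b \<noteq> 0. representation (v ` I) x b *s b) =
      (\<Sum>i\<in>{i \<in> I. co x i \<noteq> 0}. co x i *s v i)"
    by (metis (no_types, lifting) coord_def sum.reindex_cong)
  then show ?thesis
    using sum_nonzero_representation_eq[OF indep, of x] by (simp add: spans)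
qed

lemma coord_eq_0_imp_eq_0: "(\<And>i. i \<in> I \<Longrightarrow> co x i = 0) \<Longrightarrow> x = 0"
  using sum_coord[of x] by (simp cong: conj_cong)

text \<open>Coordinates are linear, so a bound on the support passes from the generators to their
  span; conversely, \<open>x\<close> is the sum of its terms.\<close>

lemma span_below_iff: "x \<in> span_below I v i \<longleftrightarrow> (\<forall>l\<in>I. co x l \<noteq> 0 \<longrightarrow> l < i)"
proof
  assume "x \<in> span_below I v i"
  then show "\<forall>l\<in>I. co x l \<noteq> 0 \<longrightarrow> l < i"
    unfolding span_below_def
  proof (induction rule: span_induct_alt)
    case base
    then show ?case by (simp add: coord_zero)
  next
    case (step c a y)
    then show ?case
      by (auto simp: coord_add coord_scale coord_basis split: if_splits)
  qed
next
  assume "\<forall>l\<in>I. co x l \<noteq> 0 \<longrightarrow> l < i"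
  then have "(\<Sum>l\<in>{l \<in> I. co x l \<noteq> 0}. co x l *s v l) \<in> span_below I v i"
    unfolding span_below_def by (intro span_sum span_scale span_base) auto
  then show "x \<in> span_below I v i" by (simp add: sum_coord)
qed

lemma leads_at_lead_index: "defines_reduction I v x \<Longrightarrow> leads_at I v x (lead_index I v x)"
  unfolding defines_reduction_def lead_index_def by (rule theI')

end

section \<open>Leading coefficients of a confluent family\<close>

locale confluent_family = ordered_basis scale I v
  for scale :: "'a::comm_ring_1 \<Rightarrow> 'b::ab_group_add \<Rightarrow> 'b" (infixr "*s" 75)
    and I :: "'i::order set" and v :: "'i \<Rightarrow> 'b" +
  fixes J :: "'j set" and w :: "'j \<Rightarrow> 'b"
  assumes confluent: "confluent_set I v J w"
begin

abbreviation S :: "'i \<Rightarrow> 'b set" where "S \<equiv> elements_at I v J w"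
abbreviation Y :: "'i \<Rightarrow> 'a set" where "Y \<equiv> lead_ideal I v J w"

lemma leads: "j \<in> J \<Longrightarrow> leads_at I v (w j) (lead_index I v (w j))"
  using confluent leads_at_lead_index by (auto simp: confluent_set_def)

lemma confluence:
  "i \<in> I \<Longrightarrow> y \<in> span (S i) \<Longrightarrow> y \<in> span_below I v i \<Longrightarrow> y \<in> span (\<Union>l\<in>{l \<in> I. l < i}. S l)"
  using confluent by (auto simp: confluent_set_def)

lemma subspace_lead_ideal: "module.subspace (*) (Y i)"
  unfolding lead_ideal_def ideal_generated_by_def
  by (rule module.subspace_span[OF module_times])

lemma span_elements_at_subset: "span (S i) \<subseteq> span (w ` J)"
  by (rule span_mono) (auto simp: elements_at_def)

lemma UN_elements_at: "(\<Union>i\<in>I. S i) = w ` J"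
  using leads by (auto simp: elements_at_def leads_at_def)

text \<open>Each generator in \<open>S i\<close> has its support at or below its leading index
  \<open>i\<close>, and linear combinations keep this bound.\<close>

lemma coord_elements_at_le:
  assumes "y \<in> span (S i)"
  shows "l \<in> I \<Longrightarrow> co y l \<noteq> 0 \<Longrightarrow> l \<le> i"
  using assms
proof (induction rule: span_induct_alt)
  case base
  then show ?case by (simp add: coord_zero)
next
  case (step c a y)
  have "co a l \<noteq> 0 \<Longrightarrow> l \<le> i"
    using step.hyps(1) step.prems(1) leads by (auto simp: elements_at_def leads_at_def)
  then show ?case
    using step by (cases "co a l = 0") (auto simp: coord_add coord_scale)
qed

lemma coord_elements_at_mem:
  assumes i: "i \<in> I" and "y \<in> span (S i)"
  shows "co y i \<in> Y i"
  using assms(2)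
proof (induction rule: span_induct_alt)
  case base
  then show ?case
    using module.subspace_0[OF module_times subspace_lead_ideal] by (simp add: coord_zero)
next
  case (step c a y)
  then obtain j where j: "j \<in> J" "lead_index I v (w j) = i" "a = w j"
    by (auto simp: elements_at_def)
  \<comment> \<open>Removing the term at \<open>i\<close> leaves only terms strictly below
    \<open>i\<close>, so \<open>a\<close> has the form required in the generating set of
    \<open>Y i\<close>.\<close>
  have "a - co a i *s v i \<in> span_below I v i"
    using leads[OF j(1)] j i
    by (auto simp: span_below_iff leads_at_def coord_diff coord_scale coord_basis split: if_splits)
  then have "co a i \<in> Y i"
    unfolding lead_ideal_def ideal_generated_by_def using j
    by (intro module.span_base[OF module_times] CollectI bexI[of _ j] conjI
        bexI[of _ "a - co a i *s v i"]) auto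
  then show ?case
    using step.IH module.subspace_add[OF module_times subspace_lead_ideal]
      module.subspace_scale[OF module_times subspace_lead_ideal]
    by (simp add: coord_add coord_scale)
qed

text \<open>The combination of leading coefficients that gives \<open>d\<close> is applied to the
  elements \<open>w j\<close> themselves. With the preceding inclusion, \<open>Y i\<close> is
  exactly the set of \<open>i\<close>-th coordinates on \<open>span (S i)\<close>, so a coefficient
  can be reduced modulo \<open>Y i\<close> by subtracting an element of that span.\<close>

lemma lead_ideal_coord_ex:
  assumes i: "i \<in> I" and "d \<in> Y i"
  shows "\<exists>y\<in>span (S i). co y i = d"
  using assms(2) unfolding lead_ideal_def ideal_generated_by_def
proof (induction rule: module.span_induct_alt[OF module_times, consumes 1, case_names base step])
  case base
  then show ?case by (intro bexI[of _ 0]) (auto simp: coord_zero span_zero)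
next
  case (step c a d)
  then obtain j u y where j: "j \<in> J" "lead_index I v (w j) = i"
    and u: "u \<in> span_below I v i" "w j = a *s v i + u"
    and y: "y \<in> span (S i)" "co y i = d"
    by blast
  have "co (w j) i = a"
    using u i by (auto simp: span_below_iff coord_add coord_scale coord_basis)
  moreover have "w j \<in> S i"
    using j by (auto simp: elements_at_def)
  ultimately show ?case
    using y by (intro bexI[of _ "c *s w j + y"])
      (auto simp: coord_add coord_scale intro: span_add span_scale span_base)
qed

text \<open>A summand \<open>y l\<close> reaches only indices at or below \<open>l\<close>; as
  nothing in \<open>F\<close> lies above \<open>m\<close>, only \<open>y m\<close> contributes at
  \<open>m\<close>.\<close>

lemma coord_sum_elements_at_maximal:
  assumes "finite F" "\<And>i. i \<in> F \<Longrightarrow> y i \<in> span (S i)"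
    and "m \<in> I" "m \<in> F" "\<And>l. l \<in> F \<Longrightarrow> \<not> m < l"
  shows "co (sum y F) m = co (y m) m"
proof -
  have "co (y l) m = 0" if "l \<in> F - {m}" for l
    using coord_elements_at_le[of "y l" l m] assms that by (auto simp: order.order_iff_strict)
  then have "(\<Sum>l\<in>F. co (y l) m) = (\<Sum>l\<in>{m}. co (y l) m)"
    using assms by (intro sum.mono_neutral_right) auto
  then show ?thesis by (simp add: coord_sum)
qed

section \<open>Uniqueness: coordinates of nonzero elements of the span\<close>

text \<open>For the difference of two normal forms of one class, this coordinate would be a
  difference of two representatives of the same residue modulo \<open>Y i\<close>, hence 0: a
  contradiction.\<close>

lemma ex_coord_mem_lead_ideal:
  assumes "x \<in> span (w ` J)" "x \<noteq> 0"
  shows "\<exists>i\<in>I. co x i \<noteq> 0 \<and> co x i \<in> Y i"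
proof -
  \<comment> \<open>The induction is on the index set of a decomposition, not on the support of
    \<open>x\<close>: the element stays fixed while its decomposition descends.\<close>
  have claim: "\<exists>i\<in>I. co x i \<noteq> 0 \<and> co x i \<in> Y i"
    if "finite F" "F \<subseteq> I" "\<And>i. y i \<in> span (S i)" "x = sum y F" for F y
    using wf_replacement that
  proof (induction F arbitrary: y rule: wf_induct_rule)
    case (less F)
    show ?case
    proof (cases "\<exists>m\<in>F. (\<forall>l\<in>F. \<not> m < l) \<and> co (y m) m \<noteq> 0")
      case True
      then obtain m where m: "m \<in> F" "\<And>l. l \<in> F \<Longrightarrow> \<not> m < l" "co (y m) m \<noteq> 0" by blast
      moreover have "m \<in> I" using m less.prems by auto
      moreover have "co x m = co (y m) m"
        unfolding less.prems(4)
        by (rule coord_sum_elements_at_maximal) (use m less.prems in auto)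
      ultimately show ?thesis
        using coord_elements_at_mem[OF \<open>m \<in> I\<close> less.prems(3)]
        by (metis (no_types))
    next
      case False
      \<comment> \<open>The new decomposition will have its indices in \<open>?D\<close>. A
        non-maximal \<open>m\<close> already lies there; only the summands at maximal indices need
        rewriting.\<close>
      let ?D = "{l \<in> I. \<exists>a\<in>F. l < a}"
      have "y m \<in> span (\<Union>l\<in>?D. S l)" if m: "m \<in> F" for m
      proof (cases "\<exists>l\<in>F. m < l")
        case True
        then have "S m \<subseteq> (\<Union>l\<in>?D. S l)" using m less.prems(2) by auto
        then show ?thesis using less.prems(3)[of m] span_mono by blast
      next
        case max: False
        \<comment> \<open>The vanishing coordinate at \<open>m\<close> turns support at or below
          \<open>m\<close> into support strictly below, so confluence applies.\<close>
        have "y m \<in> span_below I v m"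
          unfolding span_below_iff
          using coord_elements_at_le[OF less.prems(3)] False max m
          by (metis order.order_iff_strict)
        then have "y m \<in> span (\<Union>l\<in>{l \<in> I. l < m}. S l)"
          using m less.prems by (intro confluence) auto
        moreover have "(\<Union>l\<in>{l \<in> I. l < m}. S l) \<subseteq> (\<Union>l\<in>?D. S l)" using m by auto
        ultimately show ?thesis using span_mono by blast
      qed
      then have "x \<in> span (\<Union>l\<in>?D. S l)"
        unfolding less.prems(4) by (rule span_sum)
      then obtain F' y' where F': "finite F'" "F' \<subseteq> ?D" "\<And>i. y' i \<in> span (S i)" "x = sum y' F'"
        using span_UN_finite_sum[of x S ?D] by blast
      \<comment> \<open>Here \<open>x \<noteq> 0\<close> enters: the empty set has no predecessor in
        \<open>replacement\<close>.\<close>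
      have "F \<noteq> {}" using less.prems(4) assms(2) by auto
      then have "(F', F) \<in> replacement"
        using F' less.prems by (intro replacementI) auto
      from less.IH[OF this F'(1) _ F'(3,4)] show ?thesis using F'(2) by auto
    qed
  qed
  show ?thesis
    using assms(1) span_UN_finite_sum[of x S I] claim unfolding UN_elements_at by blast
qed

section \<open>Existence: reduction to normal form\<close>

lemma normal_form_ex:
  assumes R: "\<And>i c. i \<in> I \<Longrightarrow> \<exists>r\<in>R i. c - r \<in> Y i"
    and fin: "finite {i \<in> I. 0 \<notin> R i}"
  shows "\<exists>z. x - z \<in> span (w ` J) \<and> (\<forall>i\<in>I. co z i \<in> R i)"
proof -
  let ?E = "{i \<in> I. 0 \<notin> R i}"
  \<comment> \<open>The claim is strengthened to confine \<open>z\<close> to indices at or below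
    \<open>A\<close>, so that later reductions cannot disturb coefficients already fixed.
    Representatives are demanded only at those indices.\<close>
  have claim: "\<exists>z. x - z \<in> span (w ` J) \<and> (\<forall>i\<in>I. co z i \<noteq> 0 \<longrightarrow> (\<exists>a\<in>A. i \<le> a)) \<and>
      (\<forall>i\<in>I. (\<exists>a\<in>A. i \<le> a) \<longrightarrow> co z i \<in> R i)"
    if "finite A" "A \<subseteq> I" "{i \<in> I. co x i \<noteq> 0} \<subseteq> A" for A x
    using wf_replacement that
  proof (induction A arbitrary: x rule: wf_induct_rule)
    case (less A)
    show ?case
    proof (cases "A = {}")
      case True
      then have "x = 0" using less.prems(3) by (intro coord_eq_0_imp_eq_0) auto
      then show ?thesis using True by (intro exI[of _ 0]) (auto simp: coord_zero span_zero)
    next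
      case False
      define M where "M = {m \<in> A. \<forall>a\<in>A. \<not> m < a}"
      have M: "finite M" "M \<subseteq> I" "M \<subseteq> A" using less.prems by (auto simp: M_def)
      have "\<exists>r y. r \<in> R m \<and> y \<in> span (S m) \<and> co y m = co x m - r" if "m \<in> I" for m
        using R[OF that, of "co x m"] lead_ideal_coord_ex[OF that] by blast
      then obtain r y where r: "\<And>m. m \<in> I \<Longrightarrow> r m \<in> R m"
        and y: "\<And>m. m \<in> I \<Longrightarrow> y m \<in> span (S m)" "\<And>m. m \<in> I \<Longrightarrow> co (y m) m = co x m - r m"
        by metis
      \<comment> \<open>\<open>p\<close> holds the finished terms, \<open>q\<close> is discarded
        modulo the span of the family, and \<open>x'\<close> is the remainder still to be
        reduced.\<close>
      define p where "p = (\<Sum>m\<in>M. r m *s v m)"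
      define q where "q = sum y M"
      define x' where "x' = x - p - q"
      have p: "co p i = (if i \<in> M then r i else 0)" if "i \<in> I" for i
        unfolding p_def using coord_basis_sum[OF M(1,2) that] .
      have q: "q \<in> span (w ` J)"
        unfolding q_def using y(1) M span_elements_at_subset by (intro span_sum) blast
      \<comment> \<open>On \<open>M\<close> the coordinates of \<open>x\<close>, \<open>p\<close>
        and \<open>q\<close> cancel. Elsewhere a nonzero coordinate comes from \<open>x\<close>, so
        \<open>l\<close> is a non-maximal member of \<open>A\<close>, or from \<open>q\<close>, so
        \<open>l\<close> lies under a member of \<open>M\<close>.\<close>
      have below: "\<exists>a\<in>A. l < a" if l: "l \<in> I" "co x' l \<noteq> 0" for l
      proof (cases "l \<in> M")
        case True
        have "co q l = co (y l) l"
          unfolding q_def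
          by (rule coord_sum_elements_at_maximal) (use True M y(1) in \<open>auto simp: M_def\<close>)
        then have "co x' l = 0"
          using True l p y(2) by (simp add: x'_def coord_diff)
        with l show ?thesis by simp
      next
        case nM: False
        then have "co x l \<noteq> 0 \<or> co q l \<noteq> 0"
          using l p by (auto simp: x'_def coord_diff)
        then show ?thesis
        proof
          assume "co x l \<noteq> 0"
          then show ?thesis using nM l less.prems(3) by (auto simp: M_def)
        next
          assume "co q l \<noteq> 0"
          then obtain m where m: "m \<in> M" "co (y m) l \<noteq> 0"
            unfolding q_def coord_sum by (meson sum.neutral)
          then have "l \<le> m" using coord_elements_at_le[OF y(1) l(1)] M by blast
          with m nM have "l < m" by (auto simp: order.order_iff_strict)
          then show ?thesis using m M(3) by blast
        qed
      qed
      \<comment> \<open>The exceptional indices strictly below \<open>A\<close> join the remaining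
        support, since the coordinate 0 would not be allowed there.\<close>
      define A' where "A' = {i \<in> I. co x' i \<noteq> 0} \<union> {i \<in> ?E. \<exists>a\<in>A. i < a}"
      have "finite {i \<in> ?E. \<exists>a\<in>A. i < a}"
        by (rule finite_subset[OF _ fin]) blast
      then have A': "finite A'" "A' \<subseteq> I"
        using finite_support[of x'] by (simp_all add: A'_def subset_iff)
      have A'_below: "\<exists>a\<in>A. i < a" if "i \<in> A'" for i
        using that below by (auto simp only: A'_def Un_iff mem_Collect_eq)
      have dec: "(A', A) \<in> replacement"
        using A'(1) less.prems(1) A'(2) less.prems(2) False A'_below by (rule replacementI)
      have supp: "{i \<in> I. co x' i \<noteq> 0} \<subseteq> A'"
        by (simp add: A'_def)
      obtain z where z: "x' - z \<in> span (w ` J)"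
          "\<forall>i\<in>I. co z i \<noteq> 0 \<longrightarrow> (\<exists>a\<in>A'. i \<le> a)"
          "\<forall>i\<in>I. (\<exists>a\<in>A'. i \<le> a) \<longrightarrow> co z i \<in> R i"
        using less.IH[OF dec A' supp] by (elim exE conjE)
      \<comment> \<open>Strictness matters: \<open>z\<close> has no terms at \<open>M\<close>, so
        the coefficients set by \<open>p\<close> survive.\<close>
      have z_below: "\<exists>a\<in>A. i < a" if "i \<in> I" "co z i \<noteq> 0" for i
        using z(2) that A'_below by (meson order.strict_trans1)
      show ?thesis
      proof (intro exI[of _ "p + z"] conjI ballI impI)
        have "x - (p + z) = (x' - z) + q" by (simp add: x'_def)
        then show "x - (p + z) \<in> span (w ` J)" using z(1) q span_add by metis
      next
        fix i assume i: "i \<in> I" "co (p + z) i \<noteq> 0"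
        then show "\<exists>a\<in>A. i \<le> a"
        proof (cases "i \<in> M")
          case True
          then show ?thesis using M(3) by blast
        next
          case False
          then have "co z i \<noteq> 0" using i p by (simp add: coord_add)
          then show ?thesis using z_below[OF i(1)] less_imp_le by blast
        qed
      next
        fix i assume i: "i \<in> I" "\<exists>a\<in>A. i \<le> a"
        show "co (p + z) i \<in> R i"
        proof (cases "i \<in> M")
          case True
          then have "co z i = 0" using z_below[OF i(1)] by (auto simp: M_def)
          then show ?thesis using True i p r by (simp add: coord_add)
        next
          case nM: False
          then have lt: "\<exists>a\<in>A. i < a" using i by (auto simp: M_def order.order_iff_strict)
          have "co z i \<in> R i"
          proof (cases "\<exists>a\<in>A'. i \<le> a")
            case True
            then show ?thesis using z(3) i by blast
          next
            case False
            \<comment> \<open>Strictly below \<open>A\<close> but outside \<open>A'\<close>, the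
              index \<open>i\<close> is not exceptional, so its coordinate 0 is a
              representative.\<close>
            then have "i \<notin> A'" "co z i = 0" using z(2) i by blast+
            then show ?thesis using lt i by (auto simp: A'_def)
          qed
          then show ?thesis using nM i p by (simp add: coord_add)
        qed
      qed
    qed
  qed
  \<comment> \<open>Including all exceptional indices from the start makes 0 admissible at every
    index of \<open>I\<close> not at or below \<open>A\<close>.\<close>
  define A where "A = {i \<in> I. co x i \<noteq> 0} \<union> ?E"
  have A: "finite A" "A \<subseteq> I" "{i \<in> I. co x i \<noteq> 0} \<subseteq> A"
    using fin finite_support[of x] by (auto simp: A_def)
  obtain z where z: "x - z \<in> span (w ` J)"
      "\<forall>i\<in>I. co z i \<noteq> 0 \<longrightarrow> (\<exists>a\<in>A. i \<le> a)"
      "\<forall>i\<in>I. (\<exists>a\<in>A. i \<le> a) \<longrightarrow> co z i \<in> R i"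
    using claim[OF A] by (elim exE conjE)
  have "co z i \<in> R i" if i: "i \<in> I" for i
  proof (cases "\<exists>a\<in>A. i \<le> a")
    case True
    then show ?thesis using z(3) i by blast
  next
    case False
    then have "co z i = 0" "i \<notin> A" using z(2) i by blast+
    then show ?thesis using i by (simp add: A_def)
  qed
  then show ?thesis using z(1) by blast
qed

end

section \<open>Passage from coordinates to classes in V/W\<close>

theorem propositionA2p3:
  fixes scale :: "'a::comm_ring_1 \<Rightarrow> 'b::ab_group_add \<Rightarrow> 'b"
    and I :: "'i::order set" and v :: "'i \<Rightarrow> 'b"
    and J :: "'j set" and w :: "'j \<Rightarrow> 'b"
    and W :: "'b set" and R :: "'i \<Rightarrow> 'a set"
  assumes "module scale"
    and "module.is_basis scale I v"
    and "descending_chain_condition I"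
    and "module.subspace scale W"
    and "module.confluent_spanning_set scale I v J w W"
    and "\<And>i. i \<in> I \<Longrightarrow> representatives_mod (module.lead_ideal scale I v J w i) (R i)"
    and "finite {i \<in> I. 0 \<notin> R i}"
  shows "\<forall>C \<in> UNIV // cong_mod W.
    \<exists>!\<mu> :: 'i \<Rightarrow> 'a.
      (\<forall>i\<in>I. \<mu> i \<in> R i) \<and> (\<forall>i. i \<notin> I \<longrightarrow> \<mu> i = 0) \<and> finite {i \<in> I. \<mu> i \<noteq> 0} \<and>
      C = cong_mod W `` {\<Sum>i \<in> {i \<in> I. \<mu> i \<noteq> 0}. scale (\<mu> i) (v i)}"
proof -
  interpret module scale by (rule assms(1))
  have confl: "confluent_set I v J w" and W: "span (w ` J) = W"
    using assms(5) by (auto simp: confluent_spanning_set_def)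
  interpret confluent_family scale I v J w
    using assms(2,3) confl by unfold_locales
  note class_eq = cong_mod_class_eq_iff[OF assms(4)]
  define val where "val \<mu> = (\<Sum>i\<in>{i \<in> I. \<mu> i \<noteq> 0}. scale (\<mu> i) (v i))" for \<mu> :: "'i \<Rightarrow> 'a"
  have coord_val: "co (val \<mu>) i = \<mu> i" if "finite {i \<in> I. \<mu> i \<noteq> 0}" "i \<in> I" for \<mu> i
    unfolding val_def using coord_basis_sum[OF that(1) _ that(2), of \<mu>] that(2) by auto
  show ?thesis
    unfolding val_def[symmetric]
  proof
    fix C assume "C \<in> UNIV // cong_mod W"
    then obtain x where C: "C = cong_mod W `` {x}" by (auto elim: quotientE)
    obtain z where z: "x - z \<in> W" "\<And>i. i \<in> I \<Longrightarrow> co z i \<in> R i"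
      using normal_form_ex[of R x] representatives_mod_ex[OF subspace_lead_ideal assms(6)] assms(7)
      unfolding W by blast
    show "\<exists>!\<mu>. (\<forall>i\<in>I. \<mu> i \<in> R i) \<and> (\<forall>i. i \<notin> I \<longrightarrow> \<mu> i = 0) \<and> finite {i \<in> I. \<mu> i \<noteq> 0} \<and>
        C = cong_mod W `` {val \<mu>}"
    proof (rule ex_ex1I)
      \<comment> \<open>Coefficient families are functions on the whole index type; fixing the value
        0 off \<open>I\<close> makes uniqueness an equality of functions.\<close>
      let ?\<mu> = "\<lambda>i. if i \<in> I then co z i else 0"
      have supp: "{i \<in> I. ?\<mu> i \<noteq> 0} = {i \<in> I. co z i \<noteq> 0}" by auto
      have "val ?\<mu> = (\<Sum>i\<in>{i \<in> I. co z i \<noteq> 0}. scale (co z i) (v i))"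
        unfolding val_def supp by (intro sum.cong) auto
      then have "val ?\<mu> = z" by (simp only: sum_coord)
      then have "C = cong_mod W `` {val ?\<mu>}" unfolding C class_eq using z(1) by simp
      moreover have "finite {i \<in> I. ?\<mu> i \<noteq> 0}"
        unfolding supp by (rule finite_support)
      ultimately show "\<exists>\<mu>. (\<forall>i\<in>I. \<mu> i \<in> R i) \<and> (\<forall>i. i \<notin> I \<longrightarrow> \<mu> i = 0) \<and>
          finite {i \<in> I. \<mu> i \<noteq> 0} \<and> C = cong_mod W `` {val \<mu>}"
        using z(2) by (intro exI[of _ ?\<mu>] conjI) auto
    next
      fix \<mu> \<nu>
      assume \<mu>: "(\<forall>i\<in>I. \<mu> i \<in> R i) \<and> (\<forall>i. i \<notin> I \<longrightarrow> \<mu> i = 0) \<and> finite {i \<in> I. \<mu> i \<noteq> 0} \<and>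
          C = cong_mod W `` {val \<mu>}"
        and \<nu>: "(\<forall>i\<in>I. \<nu> i \<in> R i) \<and> (\<forall>i. i \<notin> I \<longrightarrow> \<nu> i = 0) \<and> finite {i \<in> I. \<nu> i \<noteq> 0} \<and>
          C = cong_mod W `` {val \<nu>}"
      let ?d = "val \<mu> - val \<nu>"
      have d: "co ?d i = \<mu> i - \<nu> i" if "i \<in> I" for i
        using \<mu> \<nu> that by (simp add: coord_diff coord_val)
      have "?d \<in> span (w ` J)" using \<mu> \<nu> class_eq W by blast
      have "?d = 0"
      proof (rule ccontr)
        assume "?d \<noteq> 0"
        with \<open>?d \<in> span (w ` J)\<close> obtain i where i: "i \<in> I" "co ?d i \<noteq> 0" "co ?d i \<in> Y i"
          using ex_coord_mem_lead_ideal by blast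
        then have "\<mu> i = \<nu> i"
          using \<mu> \<nu> d representatives_mod_unique[OF subspace_lead_ideal assms(6)] by auto
        then show False using i d by simp
      qed
      then have "\<mu> i = \<nu> i" for i
        using d[of i] \<mu> \<nu> by (cases "i \<in> I") (auto simp: coord_zero)
      then show "\<mu> = \<nu>" by blast
    qed
  qed
qed

end
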